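(* Let $M$ be a matroid with rank function $r$. Then $M$ is a fundamental transversal matroid if and only if $$r\Bigl(\bigcap_{X\in\mathcal{F}}X\Bigr)=\sum_{\mathcal{F}'\subseteq\mathcal{F}}(-1)^{|\mathcal{F}'|+1}\,r\Bigl(\bigcup_{X\in\mathcal{F}'}X\Bigr)$$ for all nonempty subsets $\mathcal{F}\subseteq\mathcal{Z}(M)$. Equivalently, $M$ is a fundamental transversal matroid if and only if this equality holds for all nonempty antichains $\mathcal{F}$ in $\mathcal{Z}(M)$; equivalently, if and only if it holds for all nonempty filters $\mathcal{F}$ in $\mathcal{Z}(M)$.
   Context: Matroids have finite ground sets; $E(M)$ is the ground set of $M$. A set $X\subseteq E(M)$ is cyclic if it is a union of circuits of $M$ (equivalently, $M|X$ has no coloops; the empty set is cyclic). $\mathcal{Z}(M)$ is the set of all cyclic flats of $M$, ordered by inclusion; it is a lattice. An antichain in $\mathcal{Z}(M)$ is a subset $\mathcal{F}\subseteq\mathcal{Z}(M)$ no two of whose members are related by inclusion. A filter in $\mathcal{Z}(M)$ is a subset $\mathcal{F}\subseteq\mathcal{Z}(M)$ such that if $A\in\mathcal{F}$, $B\in\mathcal{Z}(M)$ and $A\subseteq B$, then $B\in\mathcal{F}$. In sums over $\mathcal{F}'\subseteq\mathcal{F}$, the empty union is $\emptyset$ (so that term is $0$). A set system on a set $S$ is a finite multiset $(A_1,\ldots,A_s)$ of subsets of $S$. A partial transversal of it is a subset $I\subseteq S$ for which there is an injection $\phi:I\to\{1,\ldots,s\}$ with $x\in A_{\phi(x)}$ for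 all $x\in I$. The partial transversals are the independent sets of a matroid on $S$; such a matroid is called transversal and the set system is a presentation of it. A fundamental transversal matroid is a transversal matroid that has a presentation $(A_1,\ldots,A_s)$ for which no difference $A_i-\bigcup_{j\ne i}A_j$, for $1\le i\le s$, is empty. (Equivalently, $M$ is a matroid having a fundamental basis, that is, a basis $B$ such that each $F\in\mathcal{Z}(M)$ is spanned by $B\cap F$.) *)

theory Defs
  imports Main
begin

locale matroid =
  fixes E :: "'a set" and indep :: "'a set \<Rightarrow> bool"
  assumes finite_ground: "finite E"
    and indep_subset_ground: "indep X \<Longrightarrow> X \<subseteq> E"
    and indep_empty: "indep {}"
    and indep_subset: "indep Y \<Longrightarrow> X \<subseteq> Y \<Longrightarrow> indep X"
    and indep_augment: "indep X \<Longrightarrow> indep Y \<Longrightarrow> card X < card Y \<Longrightarrow>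
      \<exists>y\<in>Y - X. indep (insert y X)"
begin

definition rank :: "'a set \<Rightarrow> nat" where
  "rank X = Max (card ` {I. I \<subseteq> X \<and> indep I})"

definition circuit :: "'a set \<Rightarrow> bool" where
  "circuit C \<longleftrightarrow> C \<subseteq> E \<and> \<not> indep C \<and> (\<forall>D. D \<subset> C \<longrightarrow> indep D)"

definition cyclic :: "'a set \<Rightarrow> bool" where
  "cyclic X \<longleftrightarrow> (\<exists>\<C>. (\<forall>C\<in>\<C>. circuit C) \<and> X = \<Union>\<C>)"

definition flat :: "'a set \<Rightarrow> bool" where
  "flat F \<longleftrightarrow> F \<subseteq> E \<and> (\<forall>x\<in>E - F. rank F < rank (insert x F))"

definition cyclic_flats :: "'a set set" where
  "cyclic_flats = {F. flat F \<and> cyclic F}"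

definition cyclic_flat_antichain :: "'a set set \<Rightarrow> bool" where
  "cyclic_flat_antichain \<F> \<longleftrightarrow>
    \<F> \<subseteq> cyclic_flats \<and> (\<forall>A\<in>\<F>. \<forall>B\<in>\<F>. A \<subseteq> B \<longrightarrow> A = B)"

definition cyclic_flat_filter :: "'a set set \<Rightarrow> bool" where
  "cyclic_flat_filter \<F> \<longleftrightarrow>
    \<F> \<subseteq> cyclic_flats \<and> (\<forall>A\<in>\<F>. \<forall>B\<in>cyclic_flats. A \<subseteq> B \<longrightarrow> B \<in> \<F>)"

end

(* A set system on S (a finite multiset of subsets of S) is represented by a list As with
   set As \<subseteq> Pow S; the order of the list is irrelevant and repetitions are allowed. The list
   index i < length As plays the role of the index in {1,...,s}. *)
definition partial_transversal :: "'a set \<Rightarrow> 'a set list \<Rightarrow> 'a set \<Rightarrow> bool" where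
  "partial_transversal S As I \<longleftrightarrow>
    I \<subseteq> S \<and> (\<exists>\<phi>. inj_on \<phi> I \<and> \<phi> ` I \<subseteq> {..<length As} \<and> (\<forall>x\<in>I. x \<in> As ! \<phi> x))"

context matroid
begin

definition presentation :: "'a set list \<Rightarrow> bool" where
  "presentation As \<longleftrightarrow>
    set As \<subseteq> Pow E \<and> (\<forall>I. indep I \<longleftrightarrow> partial_transversal E As I)"

definition transversal :: bool where
  "transversal \<longleftrightarrow> (\<exists>As. presentation As)"

definition fundamental_transversal :: bool where
  "fundamental_transversal \<longleftrightarrow>
    transversal \<and>
    (\<exists>As. presentation As \<and>
      (\<forall>i<length As. As ! i - (\<Union>j\<in>{..<length As} - {i}. As ! j) \<noteq> {}))"

(* Stated over int because of the signs. The sum includes the empty subfamily, which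
   contributes rank {} = 0. *)
definition rank_incl_excl :: "'a set set \<Rightarrow> bool" where
  "rank_incl_excl \<F> \<longleftrightarrow>
    int (rank (\<Inter>\<F>)) = (\<Sum>\<F>'\<in>Pow \<F>. (- 1) ^ (card \<F>' + 1) * int (rank (\<Union>\<F>')))"

end

end

theory Submission
  imports Defs
begin

text \<open>
  Being fundamental transversal amounts to having a basis \<open>B\<close> that meets every cyclic flat
  \<open>X\<close> in \<open>rank X\<close> elements. For such a basis, \<open>rank\<close> agrees with \<open>\<lambda>X. card (B \<inter> X)\<close> also on
  unions and on intersections of cyclic flats, so the rank equality is the inclusion-exclusion
  principle. Conversely, Moebius inversion gives weights \<open>\<beta>\<close> on the cyclic flats such that
  \<open>rank X\<close> is the total weight of the cyclic flats not containing \<open>X\<close>. The rank equalities show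
  that for each cyclic flat \<open>G\<close> one can choose \<open>\<beta> G\<close> elements that lie in exactly those cyclic
  flats not contained in \<open>G\<close>. The chosen elements meet each cyclic flat \<open>X\<close> in \<open>rank X\<close>
  elements, hence contain no circuit, and extend to the desired basis.
\<close>

section \<open>Alternating sums over subfamilies\<close>

lemma sum_Pow_alternating:
  assumes "finite A"
  shows "(\<Sum>S\<in>Pow A. (- 1) ^ card S) = (if A = {} then 1 else 0 :: int)"
  using assms
proof (induction A)
  case empty
  then show ?case by simp
next
  case (insert a A)
  have disj: "Pow A \<inter> insert a ` Pow A = {}"
    using insert.hyps by auto
  have inj: "inj_on (insert a) (Pow A)"
    using insert.hyps by (auto simp: inj_on_def)
  have "(\<Sum>S\<in>insert a ` Pow A. (- 1) ^ card S) = (\<Sum>S\<in>Pow A. (- 1) ^ card (insert a S) :: int)"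
    by (simp add: sum.reindex[OF inj])
  also have "\<dots> = (\<Sum>S\<in>Pow A. - ((- 1) ^ card S))"
  proof (rule sum.cong[OF refl])
    fix S assume "S \<in> Pow A"
    then have "a \<notin> S" "finite S"
      using insert.hyps finite_subset by auto
    then show "(- 1) ^ card (insert a S) = - ((- 1) ^ card S :: int)" by simp
  qed
  finally have "(\<Sum>S\<in>insert a ` Pow A. (- 1) ^ card S) = - (\<Sum>S\<in>Pow A. (- 1) ^ card S :: int)"
    by (simp add: sum_negf)
  then show ?case
    unfolding Pow_insert using insert.hyps disj by (simp add: sum.union_disjoint)
qed

text \<open>\<open>\<exists>X\<in>S. P X\<close> fails exactly when \<open>S\<close> consists of
  members violating \<open>P\<close>. So the sum is a difference of alternating sums over two power
  sets, that of \<open>?N\<close> and that of \<open>A\<close>; the second vanishes as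
  \<open>A\<close> is nonempty, the first unless \<open>?N\<close> is empty.\<close>

lemma sum_Pow_alternating_Bex:
  assumes "finite A" "A \<noteq> {}"
  shows "(\<Sum>S\<in>Pow A. (- 1) ^ (card S + 1) * of_bool (\<exists>X\<in>S. P X))
    = (of_bool (\<forall>X\<in>A. P X) :: int)"
proof -
  let ?N = "{X \<in> A. \<not> P X}"
  have "(\<Sum>S\<in>Pow A. (- 1) ^ (card S + 1) * of_bool (\<exists>X\<in>S. P X))
      = (\<Sum>S\<in>Pow A. (if S \<in> Pow ?N then (- 1) ^ card S else 0) - (- 1) ^ card S :: int)"
    by (rule sum.cong) auto
  also have "\<dots> = (\<Sum>S\<in>Pow A \<inter> Pow ?N. (- 1) ^ card S) - (\<Sum>S\<in>Pow A. (- 1) ^ card S)"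
    using assms by (simp only: sum_subtractf sum.inter_restrict finite_Pow_iff)
  also have "Pow A \<inter> Pow ?N = Pow ?N"
    by auto
  finally show ?thesis
    using assms by (auto simp: sum_Pow_alternating)
qed

text \<open>Interchanging the sums leaves the indicator identity for each \<open>y\<close>. It
  serves twice: with weight 1 on the elements of a basis and \<open>P\<close> as membership, and
  with weights on cyclic flats and \<open>P X Y\<close> as
  \<open>\<not> X \<subseteq> Y\<close>.\<close>

lemma sum_Pow_alternating_weighted:
  fixes w :: "'b \<Rightarrow> int"
  assumes "finite A" "A \<noteq> {}" "finite Y"
  shows "(\<Sum>S\<in>Pow A. (- 1) ^ (card S + 1) * (\<Sum>y | y \<in> Y \<and> (\<exists>X\<in>S. P X y). w y))
    = (\<Sum>y | y \<in> Y \<and> (\<forall>X\<in>A. P X y). w y)"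
proof -
  have restrict: "(\<Sum>y | y \<in> Y \<and> Q y. w y) = (\<Sum>y\<in>Y. of_bool (Q y) * w y)" for Q
    unfolding sum.inter_filter[OF \<open>finite Y\<close>] by (rule sum.cong) auto
  have "(\<Sum>S\<in>Pow A. (- 1) ^ (card S + 1) * (\<Sum>y | y \<in> Y \<and> (\<exists>X\<in>S. P X y). w y))
      = (\<Sum>S\<in>Pow A. \<Sum>y\<in>Y. (- 1) ^ (card S + 1) * of_bool (\<exists>X\<in>S. P X y) * w y)"
    by (simp only: restrict sum_distrib_left mult.assoc)
  also have "\<dots> = (\<Sum>y\<in>Y. (\<Sum>S\<in>Pow A. (- 1) ^ (card S + 1) * of_bool (\<exists>X\<in>S. P X y)) * w y)"
    by (subst sum.swap) (simp only: sum_distrib_right)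
  also have "\<dots> = (\<Sum>y\<in>Y. of_bool (\<forall>X\<in>A. P X y) * w y)"
    by (simp only: sum_Pow_alternating_Bex[OF assms(1,2)])
  finally show ?thesis
    by (simp only: restrict)
qed

text \<open>Moebius inversion for inclusion. A minimal member \<open>A\<close> of \<open>Z\<close>
  contains no other member, so its weight occurs only in the equation for \<open>X = A\<close> and
  can be chosen last to satisfy it.\<close>

lemma exists_sum_supersets_eq:
  fixes g :: "'a set \<Rightarrow> int"
  assumes "finite Z"
  shows "\<exists>\<beta>. \<forall>X\<in>Z. (\<Sum>Y | Y \<in> Z \<and> X \<subseteq> Y. \<beta> Y) = g X"
  using assms
proof (induction "card Z" arbitrary: Z)
  case 0
  then show ?case by simp
next
  case (Suc n)
  then have "Z \<noteq> {}" by auto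
  then obtain A where A: "A \<in> Z" "\<And>B. B \<in> Z \<Longrightarrow> B \<subseteq> A \<Longrightarrow> A = B"
    using finite_has_minimal[OF \<open>finite Z\<close>] by blast
  have "n = card (Z - {A})" "finite (Z - {A})"
    using Suc A by auto
  from Suc.hyps(1)[OF this] obtain \<beta>
    where \<beta>: "\<forall>X\<in>Z - {A}. (\<Sum>Y | Y \<in> Z - {A} \<and> X \<subseteq> Y. \<beta> Y) = g X"
    by blast
  define \<gamma> where "\<gamma> = \<beta>(A := g A - (\<Sum>Y | Y \<in> Z - {A} \<and> A \<subseteq> Y. \<beta> Y))"
  have "(\<Sum>Y | Y \<in> Z \<and> X \<subseteq> Y. \<gamma> Y) = g X" if X: "X \<in> Z" for X
  proof (cases "X = A")
    case True
    have "{Y. Y \<in> Z \<and> A \<subseteq> Y} = insert A {Y. Y \<in> Z - {A} \<and> A \<subseteq> Y}"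
      using A by auto
    then have "(\<Sum>Y | Y \<in> Z \<and> A \<subseteq> Y. \<gamma> Y) = \<gamma> A + (\<Sum>Y | Y \<in> Z - {A} \<and> A \<subseteq> Y. \<gamma> Y)"
      using \<open>finite Z\<close> by simp
    also have "(\<Sum>Y | Y \<in> Z - {A} \<and> A \<subseteq> Y. \<gamma> Y) = (\<Sum>Y | Y \<in> Z - {A} \<and> A \<subseteq> Y. \<beta> Y)"
      by (rule sum.cong) (auto simp: \<gamma>_def)
    finally show ?thesis
      by (simp add: True \<gamma>_def)
  next
    case False
    then have "{Y. Y \<in> Z \<and> X \<subseteq> Y} = {Y. Y \<in> Z - {A} \<and> X \<subseteq> Y}"
      using A X by auto
    then have "(\<Sum>Y | Y \<in> Z \<and> X \<subseteq> Y. \<gamma> Y) = (\<Sum>Y | Y \<in> Z - {A} \<and> X \<subseteq> Y. \<beta> Y)"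
      by (intro sum.cong) (auto simp: \<gamma>_def)
    then show ?thesis
      using \<beta> X False by simp
  qed
  then show ?case by blast
qed

section \<open>Rank and closure\<close>

context matroid
begin

lemma finite_indep: "indep I \<Longrightarrow> finite I"
  using finite_ground finite_subset indep_subset_ground by blast

lemma finite_indep_subsets: "finite {I. I \<subseteq> X \<and> indep I}"
  by (rule finite_subset[of _ "Pow E"]) (auto simp: finite_ground dest: indep_subset_ground)

lemma card_le_rank: "indep I \<Longrightarrow> I \<subseteq> X \<Longrightarrow> card I \<le> rank X"
  unfolding rank_def by (rule Max_ge) (auto simp: finite_indep_subsets)

lemma rank_witness:
  obtains I where "I \<subseteq> X" "indep I" "card I = rank X"
proof -
  have "rank X \<in> card ` {I. I \<subseteq> X \<and> indep I}"
    unfolding rank_def by (rule Max_in) (use indep_empty in \<open>auto simp: finite_indep_subsets\<close>)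
  then show thesis using that by auto
qed

lemma extend_to_basis:
  assumes "indep I" "I \<subseteq> X"
  obtains J where "I \<subseteq> J" "J \<subseteq> X" "indep J" "card J = rank X"
proof -
  have "\<exists>J. I \<subseteq> J \<and> J \<subseteq> X \<and> indep J \<and> card J = rank X"
    using assms
  proof (induction "rank X - card I" arbitrary: I)
    case 0
    then show ?case using card_le_rank[of I X] by auto
  next
    case (Suc n)
    obtain K where K: "K \<subseteq> X" "indep K" "card K = rank X"
      by (rule rank_witness)
    then obtain y where y: "y \<in> K - I" "indep (insert y I)"
      using indep_augment[of I K] Suc.prems(1) Suc.hyps(2) by force
    have "n = rank X - card (insert y I)" "insert y I \<subseteq> X"
      using y K Suc finite_indep by auto
    then show ?case
      using Suc.hyps(1)[of "insert y I"] y by auto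
  qed
  then show thesis using that by blast
qed

lemma rank_indep: "indep I \<Longrightarrow> rank I = card I"
  by (metis card_le_rank card_mono finite_indep le_antisym order_refl rank_witness)

lemma indep_if_card_le_rank:
  assumes "finite I" "card I \<le> rank I"
  shows "indep I"
  by (metis assms card_seteq rank_witness)

lemma rank_mono: "X \<subseteq> Y \<Longrightarrow> rank X \<le> rank Y"
  by (metis card_le_rank order_trans rank_witness)

lemma rank_insert_ge: "rank S \<le> rank (insert x S)"
  by (rule rank_mono) auto

lemma rank_empty: "rank {} = 0"
  using rank_indep[OF indep_empty] by simp

lemma rank_Un_le:
  assumes "finite S"
  shows "rank (A \<union> S) \<le> rank A + card S"
proof -
  obtain I where I: "I \<subseteq> A \<union> S" "indep I" "card I = rank (A \<union> S)"
    by (rule rank_witness)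
  have "card I = card (I \<inter> A) + card (I - A)"
    using card_Un_disjoint[of "I \<inter> A" "I - A"] finite_indep[OF I(2)]
    by (simp add: Int_Diff_Un Int_Diff_disjoint)
  moreover have "card (I \<inter> A) \<le> rank A"
    using I by (intro card_le_rank) (auto intro: indep_subset)
  moreover have "card (I - A) \<le> card S"
    using I assms by (intro card_mono) auto
  ultimately show ?thesis using I by simp
qed

text \<open>Elements outside \<open>E\<close> leave every rank unchanged; the restriction to
  \<open>E\<close> keeps them out of the closure.\<close>

definition closure :: "'a set \<Rightarrow> 'a set" where
  "closure S = {x \<in> E. rank (insert x S) = rank S}"

lemma closure_subset_ground: "closure S \<subseteq> E"
  by (auto simp: closure_def)

lemma subset_closure: "S \<subseteq> E \<Longrightarrow> S \<subseteq> closure S"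
  by (auto simp: closure_def insert_absorb)

text \<open>Maximal independent subsets are chosen nested: \<open>J\<close> in \<open>A\<close>,
  \<open>K\<close> in \<open>B\<close>, \<open>L\<close> in \<open>insert x B\<close>. If
  \<open>x\<close> raised the rank of \<open>B\<close>, then \<open>L\<close> would contain
  \<open>x\<close> besides \<open>K\<close>, so \<open>insert x J\<close> would be independent and
  \<open>x\<close> would raise the rank of \<open>A\<close>.\<close>

lemma closure_mono:
  assumes "A \<subseteq> B"
  shows "closure A \<subseteq> closure B"
proof
  fix x assume x: "x \<in> closure A"
  obtain J where J: "J \<subseteq> A" "indep J" "card J = rank A"
    by (rule rank_witness)
  obtain K where K: "J \<subseteq> K" "K \<subseteq> B" "indep K" "card K = rank B"
    using extend_to_basis[of J B] J assms by auto
  obtain L where L: "K \<subseteq> L" "L \<subseteq> insert x B" "indep L" "card L = rank (insert x B)"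
    using extend_to_basis[of K "insert x B"] K by auto
  have "rank (insert x B) = rank B"
  proof (rule ccontr)
    assume "rank (insert x B) \<noteq> rank B"
    then have "K \<noteq> L"
      using K L by auto
    then obtain y where y: "y \<in> L" "y \<notin> K"
      using L by auto
    have yK: "indep (insert y K)"
      using L y by (auto intro: indep_subset)
    have "y \<notin> B"
    proof
      assume "y \<in> B"
      then have "card (insert y K) \<le> rank B"
        using yK K by (auto intro: card_le_rank)
      then show False
        using y K finite_indep by simp
    qed
    then have "y = x"
      using y L by auto
    then have "indep (insert x J)" "x \<notin> J"
      using yK y K by (auto intro: indep_subset[OF yK])
    then have "Suc (card J) \<le> rank (insert x A)"
      using card_le_rank[of "insert x J" "insert x A"] J finite_indep by auto
    then show False
      using x J by (auto simp: closure_def)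
  qed
  then show "x \<in> closure B"
    using x by (auto simp: closure_def)
qed

lemma rank_Un_closure:
  assumes "Y \<subseteq> closure A"
  shows "rank (A \<union> Y) = rank A"
proof -
  have "finite Y"
    using finite_subset[OF order_trans[OF assms closure_subset_ground] finite_ground] .
  then show ?thesis
    using assms
  proof (induction Y)
    case (insert y Y)
    then have "y \<in> closure (A \<union> Y)"
      using closure_mono[of A "A \<union> Y"] by auto
    then show ?case
      using insert by (auto simp: closure_def)
  qed simp
qed

lemma rank_eq_of_subset_closure:
  assumes "A \<subseteq> Y" "Y \<subseteq> closure A"
  shows "rank Y = rank A"
  using rank_Un_closure[OF assms(2)] assms(1) by (simp add: Un_absorb1)

lemma rank_closure: "S \<subseteq> E \<Longrightarrow> rank (closure S) = rank S"
  by (simp add: rank_eq_of_subset_closure subset_closure)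

lemma closure_subsetI:
  assumes "A \<subseteq> closure B"
  shows "closure A \<subseteq> closure B"
proof
  fix x assume "x \<in> closure A"
  then have "x \<in> closure (B \<union> A)"
    using closure_mono[of A "B \<union> A"] by auto
  then have "rank (insert x (B \<union> A)) = rank B"
    using rank_Un_closure[OF assms] by (auto simp: closure_def)
  moreover have "rank (insert x B) \<le> rank (insert x (B \<union> A))" "rank B \<le> rank (insert x B)"
    by (auto intro!: rank_mono)
  ultimately show "x \<in> closure B"
    using \<open>x \<in> closure A\<close> by (auto simp: closure_def)
qed

lemma rank_insert_le: "rank (insert x S) \<le> Suc (rank S)"
  using rank_Un_le[of "{x}" S] by simp

text \<open>Since \<open>x\<close> raises the rank of \<open>S\<close>, the rank of
  \<open>insert x S\<close> already reaches that of \<open>insert y S\<close>, which exceeds that of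
  \<open>S\<close> by at most one. As \<open>x\<close> adds nothing to \<open>insert y S\<close>,
  \<open>y\<close> adds nothing to \<open>insert x S\<close>.\<close>

lemma closure_exchange:
  assumes "x \<in> closure (insert y S)" "x \<notin> closure S" "y \<in> E"
  shows "y \<in> closure (insert x S)"
proof -
  have "rank (insert x S) \<noteq> rank S"
    using assms by (auto simp: closure_def)
  then have "Suc (rank S) \<le> rank (insert x S)"
    using rank_insert_ge[of S x] by auto
  moreover have "rank (insert y (insert x S)) = rank (insert y S)"
    using assms by (simp add: closure_def insert_commute)
  moreover have "rank (insert x S) \<le> rank (insert y (insert x S))"
    by (rule rank_mono) auto
  ultimately show ?thesis
    using assms(3) rank_insert_le[of y S] by (simp add: closure_def)
qed

lemma indep_insertI:
  assumes "indep I" "x \<in> E" "x \<notin> closure I"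
  shows "indep (insert x I)"
proof (rule indep_if_card_le_rank)
  show "finite (insert x I)"
    using assms finite_indep by simp
  have "rank I < rank (insert x I)"
    using assms rank_insert_ge[of I x] by (auto simp: closure_def)
  then show "card (insert x I) \<le> rank (insert x I)"
    using rank_indep[OF assms(1)] finite_indep[OF assms(1)] by (simp add: card_insert_if)
qed

lemma not_in_closure_Diff:
  assumes "indep I" "x \<in> I"
  shows "x \<notin> closure (I - {x})"
proof -
  have "rank (I - {x}) = card (I - {x})" "rank I = card I"
    using assms indep_subset[of I "I - {x}"] by (auto simp: rank_indep simp del: card_Diff_insert)
  moreover have "card (I - {x}) < card I"
    using assms finite_indep by (intro psubset_card_mono) auto
  ultimately show ?thesis
    using assms by (auto simp: closure_def insert_absorb)
qed

lemma subset_closure_if_rank_le: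
  assumes "A \<subseteq> X" "X \<subseteq> E" "rank X \<le> rank A"
  shows "X \<subseteq> closure A"
proof
  fix x assume "x \<in> X"
  then have "rank (insert x A) \<le> rank X"
    using assms by (intro rank_mono) auto
  then show "x \<in> closure A"
    using assms \<open>x \<in> X\<close> rank_insert_ge[of A x] by (auto simp: closure_def)
qed

text \<open>For \<open>x \<notin> B\<close>, the spanning set below together with \<open>x\<close> is the fundamental circuit of \<open>x\<close>
  with respect to \<open>B\<close>.\<close>

lemma closure_fundamental:
  assumes "indep B" "x \<in> closure B"
  shows "x \<in> closure {y \<in> B. x \<notin> closure (B - {y})}"
proof -
  have "finite {D. D \<subseteq> B \<and> x \<in> closure D}" "B \<in> {D. D \<subseteq> B \<and> x \<in> closure D}"
    using assms finite_indep by auto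
  then obtain D where D: "D \<subseteq> B" "x \<in> closure D"
    and min: "\<And>D'. D' \<subseteq> B \<Longrightarrow> x \<in> closure D' \<Longrightarrow> D' \<subseteq> D \<Longrightarrow> D = D'"
    using finite_has_minimal[of "{D. D \<subseteq> B \<and> x \<in> closure D}"]
    by (metis (no_types, lifting) empty_iff mem_Collect_eq)
  \<comment> \<open>If some \<open>y\<close> in the minimal spanning set \<open>D\<close> were
    dispensable in \<open>B\<close> for spanning \<open>x\<close>, exchange would put
    \<open>y\<close> into the closure of \<open>B - {y}\<close>, against independence.\<close>
  have "D \<subseteq> {y \<in> B. x \<notin> closure (B - {y})}"
  proof safe
    fix y assume y: "y \<in> D"
    then show "y \<in> B" using D by auto
    assume x: "x \<in> closure (B - {y})"
    have "x \<notin> closure (D - {y})"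
      using min[of "D - {y}"] D y by auto
    moreover have "x \<in> closure (insert y (D - {y}))"
      using D y by (simp add: insert_absorb)
    moreover have "y \<in> E"
      using D y assms indep_subset_ground by auto
    ultimately have "y \<in> closure (insert x (D - {y}))"
      by (intro closure_exchange[of x y "D - {y}"])
    also have "\<dots> \<subseteq> closure (B - {y})"
      using x D subset_closure[of "B - {y}"] indep_subset_ground[OF assms(1)]
      by (intro closure_subsetI) auto
    finally show False
      using not_in_closure_Diff[OF assms(1), of y] D y by auto
  qed
  then show ?thesis
    using closure_mono D by blast
qed

section \<open>Circuits and cyclic flats\<close>

lemma exists_circuit:
  assumes "X \<subseteq> E" "\<not> indep X"
  obtains C where "C \<subseteq> X" "circuit C"
proof -
  have "finite X" using assms(1) finite_ground by (rule finite_subset)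
  then have "finite {D. D \<subseteq> X \<and> \<not> indep D}" "X \<in> {D. D \<subseteq> X \<and> \<not> indep D}"
    using assms(2) by auto
  then obtain C where C: "C \<subseteq> X" "\<not> indep C"
    and min: "\<And>D. D \<subseteq> X \<Longrightarrow> \<not> indep D \<Longrightarrow> D \<subseteq> C \<Longrightarrow> C = D"
    using finite_has_minimal[of "{D. D \<subseteq> X \<and> \<not> indep D}"]
    by (metis (no_types, lifting) empty_iff mem_Collect_eq)
  have "circuit C"
    unfolding circuit_def using C min assms by blast
  then show thesis using C that by blast
qed

lemma rank_circuit:
  assumes "circuit C"
  shows "rank C < card C"
proof -
  have "finite C" "\<not> indep C"
    using assms finite_ground finite_subset unfolding circuit_def by blast+
  then show ?thesis
    using indep_if_card_le_rank[of C] by linarith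
qed

lemma in_closure_circuit_Diff:
  assumes "circuit C" "x \<in> C"
  shows "x \<in> closure (C - {x})"
proof (rule ccontr)
  assume "x \<notin> closure (C - {x})"
  moreover have "indep (C - {x})" "x \<in> E"
    using assms by (auto simp: circuit_def)
  ultimately have "indep (insert x (C - {x}))"
    by (intro indep_insertI)
  then show False
    using assms by (simp add: circuit_def insert_absorb)
qed

text \<open>A maximal independent subset of \<open>S\<close> already has the rank of
  \<open>insert x S\<close>, so adding \<open>x\<close> makes it dependent, and the circuit that
  appears must use \<open>x\<close>.\<close>

lemma exists_circuit_of_closure:
  assumes "x \<in> closure S" "x \<notin> S"
  obtains C where "x \<in> C" "C \<subseteq> insert x S" "circuit C"
proof -
  obtain J where J: "J \<subseteq> S" "indep J" "card J = rank S"
    by (rule rank_witness)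
  have "\<not> indep (insert x J)"
  proof
    assume "indep (insert x J)"
    then have "card (insert x J) \<le> rank (insert x S)"
      using J(1) by (intro card_le_rank) auto
    moreover have "card (insert x J) = Suc (card J)"
      using J(1) assms(2) finite_indep[OF J(2)] by (intro card_insert_disjoint) auto
    ultimately show False
      using assms(1) J(3) by (simp add: closure_def)
  qed
  moreover have "insert x J \<subseteq> E"
    using assms J indep_subset_ground by (auto simp: closure_def)
  ultimately obtain C where C: "C \<subseteq> insert x J" "circuit C"
    using exists_circuit by blast
  have "x \<in> C"
    using C J(2) indep_subset[of J C] by (auto simp: circuit_def)
  then show thesis using C J that by blast
qed

lemma cyclic_iff: "cyclic X \<longleftrightarrow> (\<forall>x\<in>X. \<exists>C. circuit C \<and> x \<in> C \<and> C \<subseteq> X)"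
proof
  assume "\<forall>x\<in>X. \<exists>C. circuit C \<and> x \<in> C \<and> C \<subseteq> X"
  then have "X = \<Union>{C. circuit C \<and> C \<subseteq> X}" by blast
  then show "cyclic X"
    unfolding cyclic_def by (intro exI[of _ "{C. circuit C \<and> C \<subseteq> X}"]) auto
qed (auto simp: cyclic_def)

lemma cyclic_subset_ground: "cyclic X \<Longrightarrow> X \<subseteq> E"
  by (auto simp: cyclic_def circuit_def)

lemma cyclic_Union: "(\<And>X. X \<in> \<F> \<Longrightarrow> cyclic X) \<Longrightarrow> cyclic (\<Union>\<F>)"
  unfolding cyclic_iff by (meson Union_iff Union_upper order_trans)

lemma closure_flat: "flat F \<Longrightarrow> closure F = F"
  unfolding flat_def closure_def by (auto simp: insert_absorb) (metis DiffI less_irrefl)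

lemma closure_cyclic_flat:
  assumes "cyclic X"
  shows "closure X \<in> cyclic_flats"
proof -
  have X: "X \<subseteq> E" using assms by (rule cyclic_subset_ground)
  have "flat (closure X)"
    unfolding flat_def
  proof (intro conjI ballI closure_subset_ground)
    fix x assume "x \<in> E - closure X"
    then have "rank X < rank (insert x X)"
      using rank_insert_ge[of X x] by (auto simp: closure_def)
    also have "\<dots> \<le> rank (insert x (closure X))"
      using subset_closure[OF X] by (intro rank_mono) auto
    finally show "rank (closure X) < rank (insert x (closure X))"
      using rank_closure[OF X] by simp
  qed
  \<comment> \<open>An element added by the closure lies on a circuit whose other elements are in
    \<open>X\<close>.\<close>
  moreover have "cyclic (closure X)"
    unfolding cyclic_iff
  proof
    fix x assume x: "x \<in> closure X"
    show "\<exists>C. circuit C \<and> x \<in> C \<and> C \<subseteq> closure X"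
    proof (cases "x \<in> X")
      case True
      then show ?thesis
        using assms subset_closure[OF X] unfolding cyclic_iff by (meson order_trans)
    next
      case False
      then show ?thesis
        using exists_circuit_of_closure[OF x] x subset_closure[OF X]
        by (metis insert_subset order_trans)
    qed
  qed
  ultimately show ?thesis by (simp add: cyclic_flats_def)
qed

lemma finite_cyclic_flats: "finite cyclic_flats"
  by (rule finite_subset[of _ "Pow E"]) (auto simp: cyclic_flats_def flat_def finite_ground)

lemma cyclic_flat_closure: "X \<in> cyclic_flats \<Longrightarrow> closure X = X"
  by (auto simp: cyclic_flats_def closure_flat)

lemma cyclic_flat_subset_ground: "X \<in> cyclic_flats \<Longrightarrow> X \<subseteq> E"
  by (auto simp: cyclic_flats_def flat_def)

section \<open>Fundamental bases\<close>

text \<open>As \<open>B \<inter> X\<close> is independent, the count says exactly that it spans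
  \<open>X\<close>.\<close>

definition fundamental_basis :: "'a set \<Rightarrow> bool" where
  "fundamental_basis B \<longleftrightarrow>
    indep B \<and> card B = rank E \<and> (\<forall>X\<in>cyclic_flats. card (B \<inter> X) = rank X)"

lemma fundamental_basis_spans:
  assumes "fundamental_basis B" "X \<in> cyclic_flats"
  shows "X \<subseteq> closure (B \<inter> X)"
proof (rule subset_closure_if_rank_le)
  have "indep (B \<inter> X)"
    using assms by (auto simp: fundamental_basis_def intro: indep_subset)
  then show "rank X \<le> rank (B \<inter> X)"
    using assms by (simp add: rank_indep fundamental_basis_def)
qed (use assms cyclic_flat_subset_ground in auto)

section \<open>Rank equalities from a fundamental basis\<close>

lemma card_fundamental_basis_Union:
  assumes "fundamental_basis B" "\<F> \<subseteq> cyclic_flats"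
  shows "rank (\<Union>\<F>) = card (B \<inter> \<Union>\<F>)"
proof -
  have "X \<subseteq> closure (B \<inter> \<Union>\<F>)" if "X \<in> \<F>" for X
    using fundamental_basis_spans[OF assms(1), of X] closure_mono[of "B \<inter> X" "B \<inter> \<Union>\<F>"]
      that assms(2) by blast
  then have "rank (\<Union>\<F>) = rank (B \<inter> \<Union>\<F>)"
    by (intro rank_eq_of_subset_closure) auto
  also have "indep (B \<inter> \<Union>\<F>)"
    using assms(1) by (auto simp: fundamental_basis_def intro: indep_subset)
  then have "rank (B \<inter> \<Union>\<F>) = card (B \<inter> \<Union>\<F>)" by (rule rank_indep)
  finally show ?thesis .
qed

text \<open>An element \<open>x\<close> of all members is spanned by \<open>B \<inter> X\<close> for
  each member \<open>X\<close>, so no element of \<open>B\<close> outside \<open>X\<close> is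
  indispensable for spanning \<open>x\<close>. Hence \<open>?D\<close>, which spans
  \<open>x\<close>, lies in the intersection.\<close>

lemma card_fundamental_basis_Inter:
  assumes "fundamental_basis B" "\<F> \<subseteq> cyclic_flats" "\<F> \<noteq> {}"
  shows "rank (\<Inter>\<F>) = card (B \<inter> \<Inter>\<F>)"
proof -
  have B: "indep B"
    using assms(1) by (simp add: fundamental_basis_def)
  have "x \<in> closure (B \<inter> \<Inter>\<F>)" if x: "x \<in> \<Inter>\<F>" for x
  proof -
    let ?D = "{y \<in> B. x \<notin> closure (B - {y})}"
    have span: "x \<in> closure (B \<inter> X)" if "X \<in> \<F>" for X
      using fundamental_basis_spans[OF assms(1), of X] that x assms(2) by auto
    have "x \<in> closure B"
      using assms(3) span closure_mono[of "B \<inter> _" B] by blast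
    then have "x \<in> closure ?D"
      using closure_fundamental B by blast
    moreover have "?D \<subseteq> B \<inter> \<Inter>\<F>"
    proof safe
      fix y X assume "y \<in> B" "x \<notin> closure (B - {y})" "X \<in> \<F>"
      then show "y \<in> X"
        using span[of X] closure_mono[of "B \<inter> X" "B - {y}"] by blast
    qed
    ultimately show ?thesis
      using closure_mono by blast
  qed
  then have "rank (\<Inter>\<F>) = rank (B \<inter> \<Inter>\<F>)"
    by (intro rank_eq_of_subset_closure) auto
  also have "\<dots> = card (B \<inter> \<Inter>\<F>)"
    using B by (auto intro!: rank_indep intro: indep_subset)
  finally show ?thesis .
qed

lemma rank_incl_excl_fundamental_basis:
  assumes "fundamental_basis B" "\<F> \<subseteq> cyclic_flats" "\<F> \<noteq> {}"
  shows "rank_incl_excl \<F>"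
proof -
  have fin: "finite B" "finite \<F>"
    using assms finite_indep finite_cyclic_flats finite_subset
    by (auto simp: fundamental_basis_def)
  have count: "int (card {b. b \<in> B \<and> Q b}) = (\<Sum>b | b \<in> B \<and> Q b. 1)" for Q
    by simp
  have "(\<Sum>\<G>\<in>Pow \<F>. (- 1) ^ (card \<G> + 1) * int (rank (\<Union>\<G>)))
      = (\<Sum>\<G>\<in>Pow \<F>. (- 1) ^ (card \<G> + 1) * (\<Sum>b | b \<in> B \<and> (\<exists>X\<in>\<G>. b \<in> X). 1))"
  proof (rule sum.cong[OF refl])
    fix \<G> assume "\<G> \<in> Pow \<F>"
    then have "rank (\<Union>\<G>) = card (B \<inter> \<Union>\<G>)"
      using card_fundamental_basis_Union[OF assms(1), of \<G>] assms(2) by auto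
    also have "B \<inter> \<Union>\<G> = {b. b \<in> B \<and> (\<exists>X\<in>\<G>. b \<in> X)}" by auto
    finally show "(- 1) ^ (card \<G> + 1) * int (rank (\<Union>\<G>))
        = (- 1) ^ (card \<G> + 1) * (\<Sum>b | b \<in> B \<and> (\<exists>X\<in>\<G>. b \<in> X). 1)"
      by simp
  qed
  also have "\<dots> = (\<Sum>b | b \<in> B \<and> (\<forall>X\<in>\<F>. b \<in> X). 1)"
    by (rule sum_Pow_alternating_weighted[OF fin(2) assms(3) fin(1)])
  also have "\<dots> = int (card {b. b \<in> B \<and> (\<forall>X\<in>\<F>. b \<in> X)})" by simp
  also have "{b. b \<in> B \<and> (\<forall>X\<in>\<F>. b \<in> X)} = B \<inter> \<Inter>\<F>" by auto
  finally show ?thesis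
    unfolding rank_incl_excl_def card_fundamental_basis_Inter[OF assms] by simp
qed

section \<open>Fundamental bases and presentations\<close>

lemma fundamental_basis_of_presentation:
  assumes "presentation As"
    and priv: "\<forall>i<length As. As ! i - (\<Union>j\<in>{..<length As} - {i}. As ! j) \<noteq> {}"
  shows "\<exists>B. fundamental_basis B"
proof -
  have ind: "indep I \<longleftrightarrow> partial_transversal E As I" for I
    using assms(1) by (simp add: presentation_def)
  \<comment> \<open>One private element \<open>b i\<close> is picked from each set; together they
    form the fundamental basis.\<close>
  have "\<forall>i. \<exists>x. i < length As \<longrightarrow> x \<in> As ! i - (\<Union>j\<in>{..<length As} - {i}. As ! j)"
    using priv by blast
  then obtain b where "\<forall>i. i < length As \<longrightarrow> b i \<in> As ! i - (\<Union>j\<in>{..<length As} - {i}. As ! j)"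
    by metis
  then have b: "i < length As \<Longrightarrow> j < length As \<Longrightarrow> b i \<in> As ! j \<longleftrightarrow> i = j" for i j
    by auto
  have inj: "inj_on b {..<length As}"
    using b by (intro inj_onI) (metis lessThan_iff)
  define B where "B = b ` {..<length As}"
  have BE: "B \<subseteq> E"
    using b assms(1) nth_mem unfolding B_def presentation_def by blast
  have "partial_transversal E As B"
    unfolding partial_transversal_def
    using BE inj b by (intro conjI exI[of _ "the_inv_into {..<length As} b"])
      (auto simp: B_def the_inv_into_f_f inj_on_def)
  then have B: "indep B" using ind by simp
  have cardB: "card {j. j < length As \<and> b j \<in> X} = card (B \<inter> X)" for X
  proof -
    have "B \<inter> X = b ` {j. j < length As \<and> b j \<in> X}"
      by (auto simp: B_def)
    moreover have "inj_on b {j. j < length As \<and> b j \<in> X}"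
      using inj by (rule inj_on_subset) auto
    ultimately show ?thesis by (simp add: card_image)
  qed
  \<comment> \<open>If \<open>X\<close> contains the private element of every set that it meets,
    then an independent subset of \<open>X\<close> is matched into the indices \<open>j\<close> with
    \<open>b j \<in> X\<close>.\<close>
  have rank_le: "rank X \<le> card (B \<inter> X)"
    if X: "\<And>i x. i < length As \<Longrightarrow> x \<in> As ! i \<Longrightarrow> x \<in> X \<Longrightarrow> b i \<in> X" for X
  proof -
    obtain I where I: "I \<subseteq> X" "indep I" "card I = rank X"
      by (rule rank_witness)
    then obtain \<phi> where \<phi>: "inj_on \<phi> I" "\<phi> ` I \<subseteq> {..<length As}" "\<forall>x\<in>I. x \<in> As ! \<phi> x"
      using ind by (auto simp: partial_transversal_def)
    have "card I = card (\<phi> ` I)"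
      using \<phi> by (simp add: card_image)
    also have "\<dots> \<le> card {j. j < length As \<and> b j \<in> X}"
    proof (intro card_mono image_subsetI CollectI conjI)
      fix x assume "x \<in> I"
      then show "\<phi> x < length As" "b (\<phi> x) \<in> X"
        using \<phi> I X[of "\<phi> x" x] by auto
    qed simp
    finally show ?thesis
      using cardB I by simp
  qed
  have "card (B \<inter> X) = rank X" if X: "X \<in> cyclic_flats" for X
  proof (rule antisym)
    show "card (B \<inter> X) \<le> rank X"
      using B by (intro card_le_rank) (auto intro: indep_subset)
    show "rank X \<le> card (B \<inter> X)"
    proof (rule rank_le, rule ccontr)
      \<comment> \<open>As \<open>x\<close> is on a circuit in \<open>X\<close>, some independent
        \<open>I\<close> of size \<open>rank X\<close> avoids \<open>x\<close>. The flat
        \<open>X\<close> misses \<open>b i\<close>, so \<open>b i\<close> can be added to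
        \<open>I\<close> and must be matched to \<open>i\<close>. Giving \<open>i\<close> to
        \<open>x\<close> instead makes \<open>insert x I\<close> independent, which is too large for
        \<open>X\<close>.\<close>
      fix i x assume i: "i < length As" and x: "x \<in> As ! i" "x \<in> X" and bi: "b i \<notin> X"
      obtain C where C: "circuit C" "x \<in> C" "C \<subseteq> X"
        using X x by (auto simp: cyclic_flats_def cyclic_iff)
      have "x \<in> closure (X - {x})"
        using in_closure_circuit_Diff[OF C(1,2)] closure_mono[of "C - {x}" "X - {x}"] C by auto
      then have rX: "rank (X - {x}) = rank X"
        using x by (simp add: closure_def insert_absorb)
      obtain I where I: "I \<subseteq> X - {x}" "indep I" "card I = rank X"
        using rank_witness[of "X - {x}"] rX by auto
      have "closure I \<subseteq> X"
        using closure_mono[of I X] I cyclic_flat_closure[OF X] by auto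
      then have "indep (insert (b i) I)"
        using bi I BE i by (intro indep_insertI) (auto simp: B_def)
      then obtain \<phi> where \<phi>: "inj_on \<phi> (insert (b i) I)"
        "\<phi> ` insert (b i) I \<subseteq> {..<length As}" "\<forall>z\<in>insert (b i) I. z \<in> As ! \<phi> z"
        using ind by (auto simp: partial_transversal_def)
      have "\<phi> (b i) = i"
        using \<phi> b[OF i, of "\<phi> (b i)"] by auto
      moreover have "b i \<notin> I"
        using bi I by auto
      ultimately have "i \<notin> \<phi> ` I"
        using \<phi>(1) by (auto simp: inj_on_def)
      then have "inj_on (\<phi>(x := i)) (insert x I)"
        using \<phi>(1) I by (auto simp: inj_on_def)
      moreover have "insert x I \<subseteq> E"
        using x I cyclic_flat_subset_ground[OF X] by auto
      ultimately have "partial_transversal E As (insert x I)"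
        unfolding partial_transversal_def
        using \<phi> x i by (intro conjI exI[of _ "\<phi>(x := i)"]) auto
      then have "card (insert x I) \<le> rank X"
        using ind I x by (intro card_le_rank) auto
      moreover have "x \<notin> I" "finite I"
        using I finite_indep by auto
      ultimately show False
        using I by simp
    qed
  qed
  moreover have "card B = rank E"
  proof (rule antisym)
    show "card B \<le> rank E" using B BE by (rule card_le_rank)
    have "rank E \<le> card (B \<inter> E)"
      using BE by (intro rank_le) (auto simp: B_def)
    then show "rank E \<le> card B" using BE by (simp add: Int_absorb2)
  qed
  ultimately show ?thesis
    using B by (auto simp: fundamental_basis_def)
qed

text \<open>This makes every independent set a partial transversal of the fundamental cocircuits of
  \<open>B\<close>. The induction trades an element of \<open>I\<close> outside \<open>B\<close> for
  one of \<open>B\<close> until \<open>I\<close> lies in \<open>B\<close>, where the identity is a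
  matching.\<close>

lemma basis_matching:
  assumes "indep B" "card B = rank E" "indep I"
  shows "\<exists>\<phi>. inj_on \<phi> I \<and> \<phi> ` I \<subseteq> B \<and> (\<forall>x\<in>I. x \<notin> closure (B - {\<phi> x}))"
  using assms(3)
proof (induction "card (I - B)" arbitrary: I)
  case 0
  then have "I \<subseteq> B"
    using finite_indep by auto
  then show ?case
    using not_in_closure_Diff[OF assms(1)] by (intro exI[of _ id]) auto
next
  case (Suc n)
  then have "I - B \<noteq> {}" by (metis card.empty nat.distinct(1))
  then obtain x where x: "x \<in> I" "x \<notin> B" by auto
  have BE: "B \<subseteq> E" using assms(1) indep_subset_ground by auto
  have "x \<in> E" using x Suc.prems indep_subset_ground by auto
  have "x \<in> closure B"
    using subset_closure_if_rank_le[OF BE order_refl] assms rank_indep \<open>x \<in> E\<close> by auto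
  then have "x \<in> closure {y \<in> B. x \<notin> closure (B - {y})}"
    using closure_fundamental assms(1) by blast
  moreover have "x \<notin> closure (I - {x})"
    using not_in_closure_Diff Suc.prems x by auto
  \<comment> \<open>The elements of \<open>B\<close> indispensable for \<open>x\<close> span
    \<open>x\<close>, but \<open>I - {x}\<close> does not; so \<open>I - {x}\<close> fails to span
    one of them.\<close>
  ultimately obtain y where y: "y \<in> B" "x \<notin> closure (B - {y})" "y \<notin> closure (I - {x})"
    using closure_subsetI[of "{y \<in> B. x \<notin> closure (B - {y})}" "I - {x}"] by blast
  have I': "indep (I - {x})" using Suc.prems by (auto intro: indep_subset)
  have yI: "y \<notin> I"
    using y x subset_closure[of "I - {x}"] indep_subset_ground[OF I'] by auto
  have "indep (insert y (I - {x}))"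
    using I' y BE by (intro indep_insertI) auto
  moreover have "insert y (I - {x}) - B = (I - B) - {x}"
    using y by auto
  then have "n = card (insert y (I - {x}) - B)"
    using Suc.hyps(2) Suc.prems x finite_indep by simp
  ultimately obtain \<phi> where \<phi>: "inj_on \<phi> (insert y (I - {x}))" "\<phi> ` insert y (I - {x}) \<subseteq> B"
    "\<forall>z\<in>insert y (I - {x}). z \<notin> closure (B - {\<phi> z})"
    using Suc.hyps(1) by blast
  \<comment> \<open>As an element of \<open>B\<close>, \<open>y\<close> can be matched only to
    itself, so after trading back \<open>x\<close> may take over \<open>y\<close>.\<close>
  have "y \<in> closure (B - {z})" if "z \<noteq> y" for z
    using y BE that subset_closure[of "B - {z}"] by auto
  then have "\<phi> y = y"
    using \<phi>(3) by blast
  then have "y \<notin> \<phi> ` (I - {x})"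
    using \<phi>(1) yI by (auto simp: inj_on_def)
  then have "inj_on (\<phi>(x := y)) I"
    using \<phi>(1) by (auto simp: inj_on_def)
  moreover have "(\<phi>(x := y)) ` I \<subseteq> B"
    using \<phi>(2) y by auto
  moreover have "\<forall>z\<in>I. z \<notin> closure (B - {(\<phi>(x := y)) z})"
    using \<phi>(3) y by auto
  ultimately show ?case by blast
qed

text \<open>The presentation consists of the fundamental cocircuits of the basis.\<close>

lemma fundamental_transversal_of_basis:
  assumes "fundamental_basis B"
  shows "fundamental_transversal"
proof -
  have B: "indep B" "card B = rank E"
    using assms by (auto simp: fundamental_basis_def)
  have BE: "B \<subseteq> E" using B indep_subset_ground by auto
  obtain bs where bs: "set bs = B" "distinct bs"
    using finite_distinct_list finite_indep B by blast
  define A where "A b = E - closure (B - {b})" for b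
  define As where "As = map A bs"
  have "indep I \<longleftrightarrow> partial_transversal E As I" for I
  proof
    assume I: "indep I"
    then obtain \<phi> where \<phi>: "inj_on \<phi> I" "\<phi> ` I \<subseteq> B" "\<forall>x\<in>I. x \<notin> closure (B - {\<phi> x})"
      using basis_matching B by blast
    have bij: "bij_betw (\<lambda>i. bs ! i) {..<length bs} B"
      using bs by (simp add: bij_betw_nth)
    \<comment> \<open>Matchings into a presentation use list positions, so each basis element is
      replaced by its position in \<open>bs\<close>.\<close>
    let ?\<psi> = "the_inv_into {..<length bs} (\<lambda>i. bs ! i) \<circ> \<phi>"
    have inv: "bij_betw (the_inv_into {..<length bs} (\<lambda>i. bs ! i)) B {..<length bs}"
      using bij by (rule bij_betw_the_inv_into)
    have "inj_on ?\<psi> I"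
      using \<phi> inv by (intro comp_inj_on) (auto simp: bij_betw_def intro: inj_on_subset)
    moreover have lt: "?\<psi> ` I \<subseteq> {..<length bs}"
      using \<phi>(2) inv by (auto simp: bij_betw_def)
    moreover have "x \<in> As ! ?\<psi> x" if "x \<in> I" for x
    proof -
      have "bs ! ?\<psi> x = \<phi> x"
        using bij \<phi>(2) that by (auto intro!: f_the_inv_into_f_bij_betw)
      moreover have "?\<psi> x < length bs" using lt that by blast
      ultimately show ?thesis
        using \<phi>(3) that I indep_subset_ground by (auto simp: As_def A_def)
    qed
    ultimately show "partial_transversal E As I"
      unfolding partial_transversal_def using I indep_subset_ground
      by (intro conjI exI[of _ ?\<psi>]) (auto simp: As_def)
  next
    assume "partial_transversal E As I"
    then obtain \<phi> where \<phi>: "I \<subseteq> E" "inj_on \<phi> I" "\<phi> ` I \<subseteq> {..<length As}" "\<forall>x\<in>I. x \<in> As ! \<phi> x"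
      unfolding partial_transversal_def by blast
    define \<psi> where "\<psi> x = bs ! \<phi> x" for x
    have lt: "\<phi> x < length bs" if "x \<in> I" for x
      using \<phi>(3) that by (auto simp: As_def)
    have inj: "inj_on \<psi> I"
      using lt \<phi>(2) bs(2) unfolding \<psi>_def inj_on_def by (metis nth_eq_iff_index_eq)
    have \<psi>: "\<psi> x \<in> B" "x \<notin> closure (B - {\<psi> x})" if "x \<in> I" for x
      using lt[OF that] \<phi>(4) that bs(1) by (auto simp: As_def A_def \<psi>_def)
    \<comment> \<open>A circuit \<open>C\<close> in \<open>I\<close> would be mapped injectively
      into \<open>B \<inter> closure C\<close>, which has only \<open>rank C\<close> elements, fewer
      than \<open>C\<close>.\<close>
    show "indep I"
    proof (rule ccontr)
      assume "\<not> indep I"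
      then obtain C where C: "C \<subseteq> I" "circuit C"
        using exists_circuit \<phi>(1) by blast
      have CE: "C \<subseteq> E" using C by (simp add: circuit_def)
      have "cyclic C"
        using C unfolding cyclic_iff by blast
      then have X: "closure C \<in> cyclic_flats"
        by (rule closure_cyclic_flat)
      \<comment> \<open>If \<open>\<psi> x\<close> were outside \<open>closure C\<close>, then
        \<open>B \<inter> closure C\<close> would span \<open>x\<close> without using
        \<open>\<psi> x\<close>.\<close>
      have "\<psi> ` C \<subseteq> B \<inter> closure C"
      proof (rule image_subsetI, rule ccontr)
        fix x assume x: "x \<in> C" and "\<psi> x \<notin> B \<inter> closure C"
        then have "B \<inter> closure C \<subseteq> B - {\<psi> x}"
          using \<psi> C by auto
        moreover have "x \<in> closure (B \<inter> closure C)"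
          using fundamental_basis_spans[OF assms X] subset_closure[OF CE] x by auto
        ultimately show False
          using closure_mono \<psi>(2) C x by blast
      qed
      then have "card (\<psi> ` C) \<le> card (B \<inter> closure C)"
        using B finite_indep by (intro card_mono) auto
      also have "\<dots> = rank C"
        using assms X rank_closure[OF CE] by (simp add: fundamental_basis_def)
      also have "\<dots> < card C" using C rank_circuit by simp
      also have "card C = card (\<psi> ` C)"
        using inj C by (metis card_image inj_on_subset)
      finally show False by simp
    qed
  qed
  then have pres: "presentation As"
    by (auto simp: presentation_def As_def A_def)
  \<comment> \<open>A basis element lies in its own fundamental cocircuit and in no other.\<close>
  moreover have "As ! i - (\<Union>j\<in>{..<length As} - {i}. As ! j) \<noteq> {}" if "i < length As" for i
  proof -
    have i: "i < length bs" using that by (simp add: As_def)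
    then have bi: "bs ! i \<in> B" using bs by auto
    have "bs ! i \<in> As ! i"
      using i bi BE not_in_closure_Diff[OF B(1)] by (auto simp: As_def A_def)
    moreover have "bs ! i \<notin> As ! j" if "j \<in> {..<length As} - {i}" for j
    proof -
      have j: "j < length bs" "j \<noteq> i" using that by (auto simp: As_def)
      then have "bs ! i \<in> B - {bs ! j}"
        using i bi bs(2) by (auto simp: nth_eq_iff_index_eq)
      then show ?thesis
        using j BE subset_closure[of "B - {bs ! j}"] by (auto simp: As_def A_def)
    qed
    ultimately show ?thesis by blast
  qed
  ultimately show ?thesis
    unfolding fundamental_transversal_def transversal_def by blast
qed

section \<open>Constructing a fundamental basis from the rank equalities\<close>

text \<open>A circuit \<open>C\<close> in \<open>B\<close> would give \<open>closure C\<close> more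
  than \<open>rank C\<close> elements of \<open>B\<close>. Extending \<open>B\<close> to a basis
  only adds elements outside all cyclic flats, since the rank bounds the independent set
  \<open>B' \<inter> X\<close>.\<close>

lemma card_Int_eq_rank_imp_fundamental_basis:
  assumes "B \<subseteq> E" "\<And>X. X \<in> cyclic_flats \<Longrightarrow> card (B \<inter> X) = rank X"
  shows "\<exists>B. fundamental_basis B"
proof -
  have fin: "finite B" using assms(1) finite_ground finite_subset by auto
  have "indep B"
  proof (rule ccontr)
    assume "\<not> indep B"
    then obtain C where C: "C \<subseteq> B" "circuit C"
      using exists_circuit assms(1) by blast
    have CE: "C \<subseteq> E" using C by (simp add: circuit_def)
    have "cyclic C"
      using C unfolding cyclic_iff by blast
    then have "card (B \<inter> closure C) = rank C"
      using assms(2) closure_cyclic_flat rank_closure[OF CE] by auto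
    moreover have "card C \<le> card (B \<inter> closure C)"
      using fin C subset_closure[OF CE] by (intro card_mono) auto
    ultimately show False using rank_circuit[OF C(2)] by simp
  qed
  then obtain B' where B': "B \<subseteq> B'" "B' \<subseteq> E" "indep B'" "card B' = rank E"
    using extend_to_basis assms(1) by blast
  have "card (B' \<inter> X) = rank X" if "X \<in> cyclic_flats" for X
  proof (rule antisym)
    show "card (B' \<inter> X) \<le> rank X"
      using B' by (intro card_le_rank) (auto intro: indep_subset)
    have "card (B \<inter> X) \<le> card (B' \<inter> X)"
      using B' finite_indep by (intro card_mono) auto
    then show "rank X \<le> card (B' \<inter> X)"
      using assms(2) that by simp
  qed
  then show ?thesis
    using B' by (auto simp: fundamental_basis_def)
qed

section \<open>Moebius weights on the cyclic flats\<close>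

definition flat_weight :: "('a set \<Rightarrow> int) \<Rightarrow> bool" where
  "flat_weight \<beta> \<longleftrightarrow>
    (\<forall>X\<in>cyclic_flats. int (rank X) = (\<Sum>Y | Y \<in> cyclic_flats \<and> \<not> X \<subseteq> Y. \<beta> Y))"

lemma exists_flat_weight: "\<exists>\<beta>. flat_weight \<beta>"
proof -
  obtain \<beta> :: "'a set \<Rightarrow> int" where \<beta>: "\<And>X. X \<in> cyclic_flats \<Longrightarrow>
      (\<Sum>Y | Y \<in> cyclic_flats \<and> X \<subseteq> Y. \<beta> Y) = int (rank E) - int (rank X)"
    using exists_sum_supersets_eq[OF finite_cyclic_flats, of "\<lambda>X. int (rank E) - int (rank X)"]
    by blast
  have split: "(\<Sum>Y\<in>cyclic_flats. \<beta> Y) = (\<Sum>Y | Y \<in> cyclic_flats \<and> X \<subseteq> Y. \<beta> Y)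
      + (\<Sum>Y | Y \<in> cyclic_flats \<and> \<not> X \<subseteq> Y. \<beta> Y)" for X
    by (subst sum.union_disjoint[symmetric])
      (auto simp: finite_cyclic_flats intro!: sum.cong)
  \<comment> \<open>The least cyclic flat has rank 0, so its equation gives total weight
    \<open>rank E\<close>; subtracting the weight of the flats containing \<open>X\<close> leaves
    \<open>rank X\<close>.\<close>
  have bot: "closure {} \<in> cyclic_flats"
    by (rule closure_cyclic_flat) (simp add: cyclic_iff)
  have "closure {} \<subseteq> Y" if "Y \<in> cyclic_flats" for Y
    using closure_mono[of "{}" Y] cyclic_flat_closure[OF that] by simp
  then have "{Y. Y \<in> cyclic_flats \<and> closure {} \<subseteq> Y} = cyclic_flats"
    by auto
  then have "(\<Sum>Y\<in>cyclic_flats. \<beta> Y) = int (rank E)"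
    using \<beta>[OF bot] rank_closure[of "{}"] rank_empty by simp
  then have "int (rank X) = (\<Sum>Y | Y \<in> cyclic_flats \<and> \<not> X \<subseteq> Y. \<beta> Y)"
    if "X \<in> cyclic_flats" for X
    using split[of X] \<beta>[OF that] by linarith
  then have "flat_weight \<beta>"
    by (simp add: flat_weight_def)
  then show ?thesis by blast
qed

text \<open>The closure of the union is a cyclic flat of the same rank, and \<open>Y\<close>
  contains it exactly when \<open>Y\<close> contains every member. Thus \<open>Y\<close> counts like
  \<open>\<beta> Y\<close> elements lying in exactly those cyclic flats not contained in
  \<open>Y\<close>.\<close>

lemma flat_weight_rank_Union:
  assumes "flat_weight \<beta>" "\<F> \<subseteq> cyclic_flats"
  shows "int (rank (\<Union>\<F>)) = (\<Sum>Y | Y \<in> cyclic_flats \<and> (\<exists>X\<in>\<F>. \<not> X \<subseteq> Y). \<beta> Y)"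
proof -
  have cyc: "cyclic (\<Union>\<F>)"
    using assms(2) by (intro cyclic_Union) (auto simp: cyclic_flats_def)
  have sub: "\<Union>\<F> \<subseteq> E" using cyc by (rule cyclic_subset_ground)
  have "closure (\<Union>\<F>) \<subseteq> Y \<longleftrightarrow> (\<forall>X\<in>\<F>. X \<subseteq> Y)" if "Y \<in> cyclic_flats" for Y
    using closure_mono[of "\<Union>\<F>" Y] subset_closure[OF sub] cyclic_flat_closure[OF that] by auto
  then have "{Y. Y \<in> cyclic_flats \<and> \<not> closure (\<Union>\<F>) \<subseteq> Y}
      = {Y. Y \<in> cyclic_flats \<and> (\<exists>X\<in>\<F>. \<not> X \<subseteq> Y)}"
    by auto
  then show ?thesis
    using assms(1) closure_cyclic_flat[OF cyc] rank_closure[OF sub]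
    unfolding flat_weight_def by metis
qed

lemma flat_weight_rank_Inter:
  assumes "flat_weight \<beta>" "\<F> \<subseteq> cyclic_flats" "\<F> \<noteq> {}" "rank_incl_excl \<F>"
  shows "int (rank (\<Inter>\<F>)) = (\<Sum>Y | Y \<in> cyclic_flats \<and> (\<forall>X\<in>\<F>. \<not> X \<subseteq> Y). \<beta> Y)"
proof -
  have "finite \<F>" using assms(2) finite_cyclic_flats finite_subset by auto
  have "int (rank (\<Inter>\<F>)) = (\<Sum>\<G>\<in>Pow \<F>. (- 1) ^ (card \<G> + 1) * int (rank (\<Union>\<G>)))"
    using assms(4) by (simp only: rank_incl_excl_def)
  also have "\<dots> = (\<Sum>\<G>\<in>Pow \<F>. (- 1) ^ (card \<G> + 1) *
      (\<Sum>Y | Y \<in> cyclic_flats \<and> (\<exists>X\<in>\<G>. \<not> X \<subseteq> Y). \<beta> Y))"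
  proof (rule sum.cong[OF refl])
    fix \<G> assume "\<G> \<in> Pow \<F>"
    then have "\<G> \<subseteq> cyclic_flats" using assms(2) by auto
    then show "(- 1) ^ (card \<G> + 1) * int (rank (\<Union>\<G>)) = (- 1) ^ (card \<G> + 1) *
        (\<Sum>Y | Y \<in> cyclic_flats \<and> (\<exists>X\<in>\<G>. \<not> X \<subseteq> Y). \<beta> Y)"
      by (simp only: flat_weight_rank_Union[OF assms(1)])
  qed
  also have "\<dots> = (\<Sum>Y | Y \<in> cyclic_flats \<and> (\<forall>X\<in>\<F>. \<not> X \<subseteq> Y). \<beta> Y)"
    by (rule sum_Pow_alternating_weighted[OF \<open>finite \<F>\<close> assms(3) finite_cyclic_flats])
  finally show ?thesis .
qed

text \<open>For a cyclic flat \<open>G\<close> let \<open>\<F>\<close> be the filter of cyclic flats not contained in \<open>G\<close>. The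
  equalities for \<open>\<F>\<close> and \<open>insert G \<F>\<close> exhibit \<open>\<beta> G\<close> as a difference of ranks, so \<open>\<Inter>\<F> - G\<close>
  has room for \<open>\<beta> G\<close> elements of the fundamental basis.\<close>

lemma exists_fundamental_basis:
  assumes \<beta>: "flat_weight \<beta>"
    and eq: "\<And>\<F>. \<F> \<noteq> {} \<Longrightarrow> cyclic_flat_filter \<F> \<Longrightarrow>
      int (rank (\<Inter>\<F>)) = (\<Sum>Y | Y \<in> cyclic_flats \<and> (\<forall>X\<in>\<F>. \<not> X \<subseteq> Y). \<beta> Y)"
  shows "\<exists>B. fundamental_basis B"
proof -
  \<comment> \<open>The greatest cyclic flat is set apart: every cyclic flat is contained in it, so
    its filter is empty and its weight enters no rank.\<close>
  define T where "T = closure (\<Union>cyclic_flats)"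
  have cyc: "cyclic (\<Union>cyclic_flats)"
    by (rule cyclic_Union) (simp add: cyclic_flats_def)
  have T: "T \<in> cyclic_flats" "\<And>X. X \<in> cyclic_flats \<Longrightarrow> X \<subseteq> T"
    unfolding T_def using closure_cyclic_flat[OF cyc]
      subset_closure[OF cyclic_subset_ground[OF cyc]] by auto
  define P where "P G = {x \<in> E. \<forall>X\<in>cyclic_flats. x \<in> X \<longleftrightarrow> \<not> X \<subseteq> G}" for G
  have room: "0 \<le> \<beta> G \<and> \<beta> G \<le> int (card (P G))" if G: "G \<in> cyclic_flats" "G \<noteq> T" for G
  proof -
    define \<F> where "\<F> = {X \<in> cyclic_flats. \<not> X \<subseteq> G}"
    have "T \<in> \<F>" using T G by (auto simp: \<F>_def)
    then have ne: "\<F> \<noteq> {}" by auto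
    have filt: "cyclic_flat_filter \<F>" "cyclic_flat_filter (insert G \<F>)"
      using G unfolding cyclic_flat_filter_def \<F>_def by blast+
    \<comment> \<open>A cyclic flat \<open>Y\<close> contains no member of \<open>\<F>\<close>
      exactly when \<open>Y \<subseteq> G\<close>; also forbidding \<open>G \<subseteq> Y\<close>
      removes only \<open>G\<close> itself.\<close>
    have ins: "{Y. Y \<in> cyclic_flats \<and> (\<forall>X\<in>\<F>. \<not> X \<subseteq> Y)}
        = insert G {Y. Y \<in> cyclic_flats \<and> (\<forall>X\<in>insert G \<F>. \<not> X \<subseteq> Y)}"
      using G unfolding \<F>_def by blast
    have "int (rank (\<Inter>\<F>)) = \<beta> G + int (rank (\<Inter>(insert G \<F>)))"
      unfolding eq[OF ne filt(1)] eq[OF insert_not_empty filt(2)] ins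
      by (subst sum.insert) (auto simp: finite_cyclic_flats)
    moreover have "rank (\<Inter>(insert G \<F>)) \<le> rank (\<Inter>\<F>)"
      by (rule rank_mono) auto
    moreover have "rank (\<Inter>\<F>) \<le> rank (\<Inter>(insert G \<F>)) + card (P G)"
    proof -
      have "\<Inter>\<F> \<subseteq> E"
        using \<open>T \<in> \<F>\<close> T cyclic_flat_subset_ground by auto
      \<comment> \<open>A point of \<open>\<Inter>\<F>\<close> outside \<open>G\<close> lies in
        every cyclic flat not contained in \<open>G\<close> and in none that is contained in
        it.\<close>
      then have "\<Inter>\<F> \<subseteq> \<Inter>(insert G \<F>) \<union> P G"
        by (auto simp: \<F>_def P_def)
      then have "rank (\<Inter>\<F>) \<le> rank (\<Inter>(insert G \<F>) \<union> P G)"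
        by (rule rank_mono)
      also have "\<dots> \<le> rank (\<Inter>(insert G \<F>)) + card (P G)"
        using finite_ground by (intro rank_Un_le) (simp add: P_def)
      finally show ?thesis .
    qed
    ultimately show ?thesis by linarith
  qed
  have "\<exists>S. S \<subseteq> P G \<and> int (card S) = \<beta> G" if "G \<in> cyclic_flats" "G \<noteq> T" for G
    using room[OF that] obtain_subset_with_card_n[of "nat (\<beta> G)" "P G"]
    by (metis int_nat_eq nat_le_iff)
  then obtain S where S: "\<And>G. G \<in> cyclic_flats \<Longrightarrow> G \<noteq> T \<Longrightarrow> S G \<subseteq> P G \<and> int (card (S G)) = \<beta> G"
    by metis
  define B where "B = (\<Union>G\<in>cyclic_flats - {T}. S G)"
  have SE: "S G \<subseteq> E" if "G \<in> cyclic_flats" "G \<noteq> T" for G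
    using S[OF that] by (auto simp: P_def)
  have mem: "x \<in> X \<longleftrightarrow> \<not> X \<subseteq> G"
    if "G \<in> cyclic_flats" "G \<noteq> T" "x \<in> S G" "X \<in> cyclic_flats" for x X G
    using S[OF that(1,2)] that by (auto simp: P_def)
  have "card (B \<inter> X) = rank X" if X: "X \<in> cyclic_flats" for X
  proof -
    let ?\<G> = "{G. G \<in> cyclic_flats \<and> \<not> X \<subseteq> G}"
    have ne: "G \<noteq> T" if "G \<in> ?\<G>" for G
      using that X T by auto
    have "B \<inter> X = (\<Union>G\<in>?\<G>. S G)"
    proof (intro equalityI subsetI)
      fix x assume "x \<in> B \<inter> X"
      then obtain G where "G \<in> cyclic_flats" "G \<noteq> T" "x \<in> S G" "x \<in> X"
        by (auto simp: B_def)
      then show "x \<in> (\<Union>G\<in>?\<G>. S G)"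
        using mem[of G x X] X by auto
    next
      fix x assume "x \<in> (\<Union>G\<in>?\<G>. S G)"
      then obtain G where "G \<in> ?\<G>" "x \<in> S G" by blast
      then show "x \<in> B \<inter> X"
        using mem[of G x X] X ne[of G] by (auto simp: B_def)
    qed
    moreover have "card (\<Union>G\<in>?\<G>. S G) = (\<Sum>G\<in>?\<G>. card (S G))"
    proof (rule card_UN_disjoint)
      show "finite ?\<G>" by (simp add: finite_cyclic_flats)
      show "\<forall>G\<in>?\<G>. finite (S G)"
        using SE ne finite_ground finite_subset by (metis (mono_tags, lifting) mem_Collect_eq)
      show "\<forall>G\<in>?\<G>. \<forall>H\<in>?\<G>. G \<noteq> H \<longrightarrow> S G \<inter> S H = {}"
      proof (intro ballI impI)
        fix G H assume GH: "G \<in> ?\<G>" "H \<in> ?\<G>" "G \<noteq> H"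
        show "S G \<inter> S H = {}"
        proof (rule equals0I)
          \<comment> \<open>A common element would determine the cyclic flats inside
            \<open>G\<close> and those inside \<open>H\<close> alike, forcing
            \<open>G = H\<close>.\<close>
          fix x assume "x \<in> S G \<inter> S H"
          then have "Y \<subseteq> G \<longleftrightarrow> Y \<subseteq> H" if "Y \<in> cyclic_flats" for Y
            using mem[of G x Y] mem[of H x Y] GH ne that by auto
          then show False using GH by blast
        qed
      qed
    qed
    ultimately have "int (card (B \<inter> X)) = (\<Sum>G\<in>?\<G>. int (card (S G)))"
      by simp
    also have "\<dots> = (\<Sum>G\<in>?\<G>. \<beta> G)"
      using S ne by (intro sum.cong) auto
    also have "\<dots> = int (rank X)"
      using \<beta> X by (simp add: flat_weight_def)
    finally show ?thesis by simp
  qed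
  moreover have "B \<subseteq> E" using SE by (auto simp: B_def)
  ultimately show ?thesis
    by (rule card_Int_eq_rank_imp_fundamental_basis[rotated])
qed

section \<open>The equivalences for families, filters and antichains\<close>

lemma fundamental_transversal_imp_rank_incl_excl:
  assumes "fundamental_transversal" "\<F> \<subseteq> cyclic_flats" "\<F> \<noteq> {}"
  shows "rank_incl_excl \<F>"
  using assms fundamental_basis_of_presentation rank_incl_excl_fundamental_basis
  unfolding fundamental_transversal_def by blast

text \<open>The construction applies the equality to filters alone, so this also settles the
  converse for arbitrary families.\<close>

lemma filters_imp_fundamental_transversal:
  assumes "\<And>\<F>. \<F> \<noteq> {} \<Longrightarrow> cyclic_flat_filter \<F> \<Longrightarrow> rank_incl_excl \<F>"
  shows "fundamental_transversal"
proof -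
  obtain \<beta> where \<beta>: "flat_weight \<beta>"
    using exists_flat_weight by blast
  have "\<exists>B. fundamental_basis B"
    using assms \<beta>
    by (intro exists_fundamental_basis[OF \<beta>] flat_weight_rank_Inter)
      (auto simp: cyclic_flat_filter_def)
  then show ?thesis
    using fundamental_transversal_of_basis by blast
qed

text \<open>Passing from a filter to its minimal members changes neither the intersection nor the
  cyclic flats that contain no member.\<close>

lemma antichains_imp_fundamental_transversal:
  assumes "\<And>\<F>. \<F> \<noteq> {} \<Longrightarrow> cyclic_flat_antichain \<F> \<Longrightarrow> rank_incl_excl \<F>"
  shows "fundamental_transversal"
proof -
  obtain \<beta> where \<beta>: "flat_weight \<beta>"
    using exists_flat_weight by blast
  have "int (rank (\<Inter>\<F>)) = (\<Sum>Y | Y \<in> cyclic_flats \<and> (\<forall>X\<in>\<F>. \<not> X \<subseteq> Y). \<beta> Y)"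
    if \<F>: "\<F> \<noteq> {}" "cyclic_flat_filter \<F>" for \<F>
  proof -
    define \<A> where "\<A> = {A \<in> \<F>. \<forall>B\<in>\<F>. B \<subseteq> A \<longrightarrow> A = B}"
    have sub: "\<F> \<subseteq> cyclic_flats" using \<F> by (simp add: cyclic_flat_filter_def)
    then have "finite \<F>" using finite_cyclic_flats finite_subset by auto
    then have below: "\<exists>A\<in>\<A>. A \<subseteq> X" if "X \<in> \<F>" for X
      using finite_has_minimal2[OF _ that] unfolding \<A>_def by blast
    have "\<A> \<subseteq> \<F>" by (auto simp: \<A>_def)
    have ne: "\<A> \<noteq> {}" using below \<F> by blast
    have "cyclic_flat_antichain \<A>"
      using sub by (auto simp: cyclic_flat_antichain_def \<A>_def)
    then have "int (rank (\<Inter>\<A>)) = (\<Sum>Y | Y \<in> cyclic_flats \<and> (\<forall>X\<in>\<A>. \<not> X \<subseteq> Y). \<beta> Y)"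
      using assms ne sub \<open>\<A> \<subseteq> \<F>\<close> by (intro flat_weight_rank_Inter[OF \<beta>]) auto
    moreover have "\<Inter>\<A> = \<Inter>\<F>"
      using below \<open>\<A> \<subseteq> \<F>\<close> by blast
    moreover have "(\<forall>X\<in>\<A>. \<not> X \<subseteq> Y) \<longleftrightarrow> (\<forall>X\<in>\<F>. \<not> X \<subseteq> Y)" for Y
      using below \<open>\<A> \<subseteq> \<F>\<close> by (meson order_trans subsetD)
    ultimately show ?thesis by simp
  qed
  then have "\<exists>B. fundamental_basis B"
    by (rule exists_fundamental_basis[OF \<beta>])
  then show ?thesis
    using fundamental_transversal_of_basis by blast
qed

end

theorem theorem4p1:
  fixes E :: "'a set" and indep :: "'a set \<Rightarrow> bool"
  assumes "matroid E indep"
  shows "(matroid.fundamental_transversal E indep \<longleftrightarrow>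
           (\<forall>\<F>. \<F> \<noteq> {} \<and> \<F> \<subseteq> matroid.cyclic_flats E indep \<longrightarrow>
              matroid.rank_incl_excl indep \<F>)) \<and>
         (matroid.fundamental_transversal E indep \<longleftrightarrow>
           (\<forall>\<F>. \<F> \<noteq> {} \<and> matroid.cyclic_flat_antichain E indep \<F> \<longrightarrow>
              matroid.rank_incl_excl indep \<F>)) \<and>
         (matroid.fundamental_transversal E indep \<longleftrightarrow>
           (\<forall>\<F>. \<F> \<noteq> {} \<and> matroid.cyclic_flat_filter E indep \<F> \<longrightarrow>
              matroid.rank_incl_excl indep \<F>))"
proof -
  interpret matroid E indep by (rule assms)
  have antichain: "\<F> \<subseteq> cyclic_flats" if "cyclic_flat_antichain \<F>" for \<F>
    using that by (simp add: cyclic_flat_antichain_def)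
  have filter: "\<F> \<subseteq> cyclic_flats" if "cyclic_flat_filter \<F>" for \<F>
    using that by (simp add: cyclic_flat_filter_def)
  show ?thesis
  proof (intro conjI iffI allI impI; (elim conjE)?)
    assume *: "\<forall>\<F>. \<F> \<noteq> {} \<and> \<F> \<subseteq> cyclic_flats \<longrightarrow> rank_incl_excl \<F>"
    show fundamental_transversal
      by (rule filters_imp_fundamental_transversal) (use * filter in simp)
  next
    assume *: "\<forall>\<F>. \<F> \<noteq> {} \<and> cyclic_flat_antichain \<F> \<longrightarrow> rank_incl_excl \<F>"
    show fundamental_transversal
      by (rule antichains_imp_fundamental_transversal) (use * in simp)
  next
    assume *: "\<forall>\<F>. \<F> \<noteq> {} \<and> cyclic_flat_filter \<F> \<longrightarrow> rank_incl_excl \<F>"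
    show fundamental_transversal
      by (rule filters_imp_fundamental_transversal) (use * in simp)
  \<comment> \<open>The three forward implications remain; antichains and filters are particular
    families of cyclic flats.\<close>
  qed (simp_all add: fundamental_transversal_imp_rank_incl_excl antichain filter)
qed

end
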